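(* There exist absolute constants $c,C>0$ such that the following holds. Let $X$ be a factor-of-IID process with finite radius $R$ over the integer lattice $\mathbb{Z}^n$ taking values $0$ or $1$. If $X$ defines an independent set (i.e. the values of two neighboring vertices cannot both be $1$), then the density of this independent set (i.e. the probability that a given vertex takes value $1$) is bounded above by $$\frac12-\frac{cn}{R\log(R/n)}$$ provided that $R>Cn$.
   Context: $\mathbb{Z}^n$ is regarded as its standard Cayley graph $G$ (a $2n$-regular transitive graph, where two points are adjacent iff they differ by $\pm$ a standard basis vector). A factor-of-IID process on $G$ with radius $R$ is $X=F(Z)$, where $Z=(Z_v)_{v\in\mathbb{Z}^n}$ are independent uniform $[0,1]$ random variables, $F:[0,1]^{\mathbb{Z}^n}\to\{0,1\}^{\mathbb{Z}^n}$ is measurable and $\mathrm{Aut}(G)$-equivariant, and each $X_v$ is a function of $Z_u$, $u\in B_R(v)$, where $B_R(v)$ is the ball of radius $R$ around $v$ with respect to the graph distance in $G$. *)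

theory Defs
  imports "HOL-Probability.Probability"
begin

text \<open>
  A graph is given by a vertex set \<open>V\<close> and a symmetric irreflexive edge relation \<open>E\<close> on \<open>V\<close>.
\<close>

definition graph_dist :: "('v \<times> 'v) set \<Rightarrow> 'v \<Rightarrow> 'v \<Rightarrow> nat" where
  \<comment> \<open>only meaningful if \<open>u\<close> and \<open>v\<close> are connected, as is always the case in the integer lattice\<close>
  "graph_dist E u v = (LEAST k. (u, v) \<in> E ^^ k)"

definition graph_ball :: "'v set \<Rightarrow> ('v \<times> 'v) set \<Rightarrow> real \<Rightarrow> 'v \<Rightarrow> 'v set" where
  "graph_ball V E R v = {u \<in> V. real (graph_dist E v u) \<le> R}"

definition graph_aut :: "'v set \<Rightarrow> ('v \<times> 'v) set \<Rightarrow> ('v \<Rightarrow> 'v) set" where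
  "graph_aut V E = {\<phi>. bij_betw \<phi> V V \<and> (\<forall>u\<in>V. \<forall>v\<in>V. (\<phi> u, \<phi> v) \<in> E \<longleftrightarrow> (u, v) \<in> E)}"

definition independent_set :: "('v \<times> 'v) set \<Rightarrow> 'v set \<Rightarrow> bool" where
  "independent_set E S \<longleftrightarrow> (\<forall>u\<in>S. \<forall>v\<in>S. (u, v) \<notin> E)"

text \<open>
  The action \<open>(\<phi> \<cdot> x)\<^sub>v = x\<^sub>w\<close> with \<open>w = \<phi>\<^sup>-\<^sup>1 v\<close>. Families indexed by \<open>V\<close> are
  extensional functions, the elements of \<open>space (PiM V _)\<close>.
\<close>

definition aut_act :: "'v set \<Rightarrow> ('v \<Rightarrow> 'v) \<Rightarrow> ('v \<Rightarrow> 'a) \<Rightarrow> 'v \<Rightarrow> 'a" where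
  "aut_act V \<phi> x = (\<lambda>v\<in>V. x (inv_into V \<phi> v))"

definition unit_interval_measure :: "real measure" where
  "unit_interval_measure = restrict_space lborel {0..1}"

text \<open>
  The joint law of independent uniform \<open>[0,1]\<close> labels; its underlying space is \<open>[0,1]\<^sup>V\<close>.
\<close>

definition iid_labels :: "'v set \<Rightarrow> ('v \<Rightarrow> real) measure" where
  "iid_labels V = (\<Pi>\<^sub>M v\<in>V. unit_interval_measure)"

text \<open>
  The labels \<open>Z\<close> are realised canonically, as the identity on the probability space
  \<open>iid_labels V\<close>, so the process is \<open>X\<^sub>v(z) = F z v\<close>.
\<close>

definition factor_of_iid ::
    "'v set \<Rightarrow> ('v \<times> 'v) set \<Rightarrow> real \<Rightarrow> (('v \<Rightarrow> real) \<Rightarrow> 'v \<Rightarrow> nat) \<Rightarrow> bool" where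
  "factor_of_iid V E R F \<longleftrightarrow>
     F \<in> iid_labels V \<rightarrow>\<^sub>M (\<Pi>\<^sub>M v\<in>V. count_space {0, 1}) \<and>
     (\<forall>\<phi>\<in>graph_aut V E. \<forall>z\<in>space (iid_labels V). F (aut_act V \<phi> z) = aut_act V \<phi> (F z)) \<and>
     (\<forall>v\<in>V. \<forall>z\<in>space (iid_labels V). \<forall>z'\<in>space (iid_labels V).
        (\<forall>u\<in>graph_ball V E R v. z u = z' u) \<longrightarrow> F z v = F z' v)"

definition int_lattice :: "nat \<Rightarrow> (nat \<Rightarrow> int) set" where
  "int_lattice n = (\<Pi>\<^sub>E i\<in>{..<n}. UNIV)"

definition int_lattice_edges :: "nat \<Rightarrow> ((nat \<Rightarrow> int) \<times> (nat \<Rightarrow> int)) set" where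
  "int_lattice_edges n =
     {(u, v). u \<in> int_lattice n \<and> v \<in> int_lattice n \<and>
              (\<exists>i<n. v = u(i := u i + 1) \<or> v = u(i := u i - 1))}"

end

theory Submission
  imports Defs
begin

text \<open>
  Let \<open>p\<close> be the density of the independent set and suppose that \<open>d = 1/2 - p\<close> is small. Then the set
  nearly alternates: multiplying \<open>2 X - 1\<close> by the parity of the site gives spins \<open>\<plusminus>1\<close>, and two
  neighbouring spins disagree only where both sites are empty, which has probability \<open>2 d\<close>. Along
  \<open>K\<close> consecutive edges of a line the spins therefore disagree with probability at most \<open>2 d K\<close>
  (lemma \<open>corr_axis\<close>). On the other hand, spins at sites further apart than \<open>2 R\<close> are independent
  (lemma \<open>rho_far\<close>). Joining two such sites by a single path along which the disagreements add up
  gives only \<open>d \<ge> const / R\<close>. The factor \<open>n\<close> is gained by using many directions at once.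

  Let \<open>\<rho>\<close> be the covariance of the spins, a positive definite function on \<open>\<int>\<^sup>n\<close>, and evaluate it
  along a simple random walk whose steps have length \<open>K\<close>. By positive definiteness, if one step
  keeps a fraction \<open>q\<close> of \<open>\<rho>(0)\<close> on average, then \<open>t\<close> steps keep at least the fraction \<open>q\<^sup>t\<close>, for \<open>t\<close> a
  power of two (lemma \<open>walk_avg_moment_lower\<close>): correlations along the walk multiply, while the
  union bound makes losses add. If \<open>t\<close> is a small multiple of \<open>n\<close>, however, most steps of the walk
  use a fresh coordinate and lead away from the origin. So with probability at least \<open>1 - (5/8)\<^sup>t\<close>
  the walk ends at distance more than \<open>K t / 2\<close> (lemma \<open>walk_avg_moment_upper\<close>). When \<open>K t > 4 R\<close>
  the covariance vanishes there, and so at most the fraction \<open>(5/8)\<^sup>t\<close> of \<open>\<rho>(0)\<close> survives. Hence one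
  step keeps at most \<open>5/8\<close> of \<open>\<rho>(0)\<close>, that is, \<open>d K\<close> is bounded below
  (lemma \<open>intensity_bound_scale\<close>).

  Since \<open>t\<close> can be taken proportional to \<open>n\<close>, the step length \<open>K\<close> is of order \<open>R / n\<close>, and the result
  is \<open>d \<ge> n / (10000 R)\<close> (lemma \<open>intensity_bound\<close>). For \<open>R > 3 n\<close> one has \<open>ln (R / n) \<ge> 1\<close>, which
  yields the stated bound.
\<close>

section \<open>Averaging along simple random walk\<close>

text \<open>
  Convolution with the step law of simple random walk on \<open>\<int>\<^sup>n\<close>: \<open>(walk_avg n ^^ t) \<phi> x\<close> is the mean
  of \<open>\<phi>\<close> at time \<open>t\<close> of the walk started at \<open>x\<close>. Points are arbitrary functions on the naturals, so
  that vector arithmetic is pointwise; only the first \<open>n\<close> coordinates move.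
\<close>
definition walk_avg :: "nat \<Rightarrow> ((nat \<Rightarrow> int) \<Rightarrow> real) \<Rightarrow> (nat \<Rightarrow> int) \<Rightarrow> real" where
  "walk_avg n \<phi> x = (\<Sum>i<n. \<phi> (x(i := x i + 1)) + \<phi> (x(i := x i - 1))) / (2 * real n)"

lemma walk_avg_mono:
  assumes "\<And>x. \<phi> x \<le> \<psi> x"
  shows "(walk_avg n ^^ t) \<phi> x \<le> (walk_avg n ^^ t) \<psi> x"
proof (induction t arbitrary: x)
  case (Suc t)
  show ?case
    unfolding funpow.simps comp_def walk_avg_def[of n "(walk_avg n ^^ t) _"]
    by (intro divide_right_mono sum_mono add_mono Suc) auto
qed (use assms in auto)

lemma walk_avg_scale:
  "(walk_avg n ^^ t) (\<lambda>x. a * \<phi> x) x = a * (walk_avg n ^^ t) \<phi> x"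
proof (induction t arbitrary: x)
  case (Suc t)
  have "(\<Sum>i<n. a * (walk_avg n ^^ t) \<phi> (x(i := x i + 1)) + a * (walk_avg n ^^ t) \<phi> (x(i := x i - 1)))
     = a * (\<Sum>i<n. (walk_avg n ^^ t) \<phi> (x(i := x i + 1)) + (walk_avg n ^^ t) \<phi> (x(i := x i - 1)))"
    by (simp add: sum_distrib_left algebra_simps)
  with Suc show ?case
    by (simp only: funpow.simps comp_def walk_avg_def[of n "(walk_avg n ^^ t) _"] times_divide_eq_right)
qed auto

lemma has_bochner_integral_walk_avg:
  assumes "\<And>x. has_bochner_integral M (\<lambda>z. \<phi> z x * g z) (\<rho> x)"
  shows "has_bochner_integral M (\<lambda>z. walk_avg n (\<phi> z) x * g z) (walk_avg n \<rho> x)"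
proof -
  have "has_bochner_integral M
      (\<lambda>z. (\<Sum>i<n. \<phi> z (x(i := x i + 1)) * g z + \<phi> z (x(i := x i - 1)) * g z) * (1 / (2 * real n)))
      ((\<Sum>i<n. \<rho> (x(i := x i + 1)) + \<rho> (x(i := x i - 1))) * (1 / (2 * real n)))"
    using assms by (intro has_bochner_integral_mult_left has_bochner_integral_sum has_bochner_integral_add) auto
  then show ?thesis
    unfolding walk_avg_def[of n "\<phi> _"] walk_avg_def[of n \<rho>]
    by (simp add: sum_distrib_right add_divide_distrib sum_divide_distrib distrib_right)
qed

lemma walk_avg_flip:
  "walk_avg n (\<lambda>x. \<rho> (\<lambda>i. y i - x i)) x = walk_avg n \<rho> (\<lambda>i. y i - x i)"
proof -
  have "(\<lambda>i. y i - (x(j := x j + 1)) i) = (\<lambda>i. y i - x i)(j := (y j - x j) - 1)"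
       "(\<lambda>i. y i - (x(j := x j - 1)) i) = (\<lambda>i. y i - x i)(j := (y j - x j) + 1)" for j
    by (auto simp: fun_eq_iff)
  then show ?thesis unfolding walk_avg_def by (simp add: add.commute)
qed

lemma walk_avg_shift:
  "walk_avg n (\<lambda>y. \<rho> (\<lambda>i. y i - x i)) y = walk_avg n \<rho> (\<lambda>i. y i - x i)"
proof -
  have "(\<lambda>i. (y(j := y j + 1)) i - x i) = (\<lambda>i. y i - x i)(j := (y j - x j) + 1)"
       "(\<lambda>i. (y(j := y j - 1)) i - x i) = (\<lambda>i. y i - x i)(j := (y j - x j) - 1)" for j
    by (auto simp: fun_eq_iff)
  then show ?thesis unfolding walk_avg_def by simp
qed

text \<open>
  Smoothing a stationary field by \<open>a\<close> steps in one place and \<open>b\<close> steps in another smooths its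
  covariance by \<open>a + b\<close> steps: covariances depend on \<open>y - x\<close> only and the step law is symmetric, so
  averages over \<open>x\<close> and over \<open>y\<close> are the same average over \<open>y - x\<close>.
\<close>
lemma walk_avg_covariance:
  assumes "\<And>x y. has_bochner_integral M (\<lambda>z. f z x * f z y) (\<rho> (\<lambda>i. y i - x i))"
  shows "has_bochner_integral M (\<lambda>z. (walk_avg n ^^ a) (f z) x * (walk_avg n ^^ b) (f z) y)
           ((walk_avg n ^^ (a + b)) \<rho> (\<lambda>i. y i - x i))"
proof (induction a arbitrary: x)
  case 0
  show ?case
  proof (induction b arbitrary: y)
    case (Suc b)
    have "has_bochner_integral M (\<lambda>z. walk_avg n ((walk_avg n ^^ b) (f z)) y * f z x)
        (walk_avg n (\<lambda>y. (walk_avg n ^^ b) \<rho> (\<lambda>i. y i - x i)) y)"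
      by (rule has_bochner_integral_walk_avg) (use Suc in \<open>simp add: mult.commute\<close>)
    then show ?case by (simp add: walk_avg_shift mult.commute)
  qed (use assms in simp)
next
  case (Suc a)
  have "has_bochner_integral M
      (\<lambda>z. walk_avg n ((walk_avg n ^^ a) (f z)) x * (walk_avg n ^^ b) (f z) y)
      (walk_avg n (\<lambda>x. (walk_avg n ^^ (a + b)) \<rho> (\<lambda>i. y i - x i)) x)"
    by (rule has_bochner_integral_walk_avg) (use Suc in simp)
  then show ?case by (simp add: walk_avg_flip)
qed

text \<open>
  By the previous lemma the smoothed covariances at the origin are inner products of smoothed copies
  of the field, so this is the Cauchy-Schwarz inequality for the field smoothed \<open>s\<close> times and the
  field itself. In spectral terms it says that \<open>(\<integral>\<lambda>\<^sup>s d\<nu>)\<^sup>2 \<le> \<integral>1 d\<nu> \<integral>\<lambda>\<^bsup>2s\<^esup> d\<nu>\<close> for the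
  spectral measure \<open>\<nu>\<close> of the field with respect to the averaging operator.
\<close>
lemma walk_avg_moment_doubling:
  assumes cov: "\<And>x y. has_bochner_integral M (\<lambda>z. f z x * f z y) (\<rho> (\<lambda>i. y i - x i))"
  shows "((walk_avg n ^^ s) \<rho> (\<lambda>_. 0))\<^sup>2 \<le> \<rho> (\<lambda>_. 0) * (walk_avg n ^^ (2 * s)) \<rho> (\<lambda>_. 0)"
proof -
  define o' :: "nat \<Rightarrow> int" where "o' = (\<lambda>_. 0)"
  define m where "m t = (walk_avg n ^^ t) \<rho> o'" for t
  define A where "A z = (walk_avg n ^^ s) (f z) o'" for z
  have AA: "has_bochner_integral M (\<lambda>z. A z * A z) (m (2 * s))"
    using walk_avg_covariance[of M f \<rho> s n o' s o', OF cov] by (simp add: A_def m_def o'_def mult_2)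
  have AF: "has_bochner_integral M (\<lambda>z. A z * f z o') (m s)"
    using walk_avg_covariance[of M f \<rho> s n o' 0 o', OF cov] by (simp add: A_def m_def o'_def)
  have FF: "has_bochner_integral M (\<lambda>z. f z o' * f z o') (m 0)"
    using cov[of o' o'] by (simp add: m_def o'_def)
  have quad: "0 \<le> a * a * m (2 * s) + (- 2 * a * b) * m s + b * b * m 0" for a b
  proof -
    have int: "has_bochner_integral M
       (\<lambda>z. a * a * (A z * A z) + (- 2 * a * b) * (A z * f z o') + b * b * (f z o' * f z o'))
       (a * a * m (2 * s) + (- 2 * a * b) * m s + b * b * m 0)"
      using AA AF FF by (intro has_bochner_integral_add has_bochner_integral_mult_right) auto
    have nonneg: "0 \<le> a * a * (A z * A z) + (- 2 * a * b) * (A z * f z o') + b * b * (f z o' * f z o')" for z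
    proof -
      have "a * a * (A z * A z) + (- 2 * a * b) * (A z * f z o') + b * b * (f z o' * f z o')
        = (a * A z - b * f z o')\<^sup>2" by (simp add: power2_eq_square algebra_simps)
      then show ?thesis by simp
    qed
    show ?thesis
      unfolding has_bochner_integral_integral_eq[OF int, symmetric]
      by (rule Bochner_Integration.integral_nonneg) (rule nonneg)
  qed
  have m0: "0 \<le> m 0" using quad[of 0 1] by simp
  have "(m s)\<^sup>2 \<le> m 0 * m (2 * s)"
  proof (cases "m 0 = 0")
    case True
    have "m s = 0"
    proof (rule ccontr)
      assume "m s \<noteq> 0"
      \<comment> \<open>With \<open>m 0 = 0\<close> the form is affine in \<open>b\<close>; at this \<open>b\<close> its value is \<open>-1\<close>.\<close>
      then show False using quad[of 1 "(m (2 * s) + 1) / (2 * m s)"] True by (simp add: field_simps)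
    qed
    then show ?thesis using True by simp
  next
    case False
    then show ?thesis using quad[of "m 0" "m s"] m0
      by (simp add: power2_eq_square algebra_simps mult_le_cancel_left)
  qed
  then show ?thesis by (simp add: m_def o'_def)
qed

text \<open>
  Iterating the doubling: a correlation \<open>q\<close> after one step forces a correlation of at least
  \<open>q\<^sup>t\<close> after \<open>t\<close> steps, for \<open>t\<close> a power of two.
\<close>
lemma walk_avg_moment_lower:
  assumes cov: "\<And>x y. has_bochner_integral M (\<lambda>z. f z x * f z y) (\<rho> (\<lambda>i. y i - x i))"
    and pos: "\<rho> (\<lambda>_. 0) > 0" and q: "0 \<le> q" "q * \<rho> (\<lambda>_. 0) \<le> walk_avg n \<rho> (\<lambda>_. 0)"
  shows "q ^ (2 ^ k) * \<rho> (\<lambda>_. 0) \<le> (walk_avg n ^^ (2 ^ k)) \<rho> (\<lambda>_. 0)"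
proof (induction k)
  case (Suc k)
  let ?r = "\<rho> (\<lambda>_. 0)" and ?t = "2 ^ k :: nat"
  have "(q ^ ?t * ?r)\<^sup>2 \<le> ((walk_avg n ^^ ?t) \<rho> (\<lambda>_. 0))\<^sup>2"
    using Suc pos q by (intro power_mono) auto
  also have "\<dots> \<le> ?r * (walk_avg n ^^ (2 * ?t)) \<rho> (\<lambda>_. 0)"
    by (rule walk_avg_moment_doubling[of M f]) (rule cov)
  finally have "?r * (q ^ (2 * ?t) * ?r) \<le> ?r * (walk_avg n ^^ (2 * ?t)) \<rho> (\<lambda>_. 0)"
    by (simp add: power2_eq_square power_mult algebra_simps mult_2 power_add)
  then show ?case using pos by simp
qed (use q in simp)

section \<open>Simple random walk escapes at linear speed\<close>

definition l1_norm :: "nat \<Rightarrow> (nat \<Rightarrow> int) \<Rightarrow> nat" where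
  "l1_norm n x = (\<Sum>i<n. nat \<bar>x i\<bar>)"

definition lattice_support :: "nat \<Rightarrow> (nat \<Rightarrow> int) \<Rightarrow> nat set" where
  "lattice_support n x = {i\<in>{..<n}. x i \<noteq> 0}"

lemma l1_upd: "i < n \<Longrightarrow> l1_norm n (x(i := a)) + nat \<bar>x i\<bar> = l1_norm n x + nat \<bar>a\<bar>"
proof -
  assume i: "i < n"
  have "l1_norm n y = nat \<bar>y i\<bar> + (\<Sum>j\<in>{..<n} - {i}. nat \<bar>y j\<bar>)" for y
    unfolding l1_norm_def using i by (intro sum.remove) auto
  note * = this[of x] this[of "x(i := a)"]
  show ?thesis by (simp add: *)
qed

lemma supp_upd: "card (lattice_support n (x(i := a))) \<le> card (lattice_support n x) + 1"
proof -
  have "lattice_support n (x(i := a)) \<subseteq> insert i (lattice_support n x)" by (auto simp: lattice_support_def)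
  then have "card (lattice_support n (x(i := a))) \<le> card (insert i (lattice_support n x))"
    by (intro card_mono) (auto simp: lattice_support_def)
  also have "\<dots> \<le> card (lattice_support n x) + 1" by (simp add: card_insert_if lattice_support_def)
  finally show ?thesis .
qed

text \<open>
  A step in a zero coordinate moves away from the origin and multiplies \<open>4\<^bsup>-|x|\<^esup>\<close> by \<open>1/4\<close>; any
  other step multiplies it by at most \<open>4\<close>. While at most a fraction \<open>1/64\<close> of the coordinates is
  nonzero, the average factor is therefore at most \<open>1/4 + 4/64 = 5/16\<close>.
\<close>
lemma walk_avg_exp_l1_step:
  assumes n: "n \<ge> 1" and s: "64 * card (lattice_support n x) \<le> n"
  shows "walk_avg n (\<lambda>x. (1/4) ^ l1_norm n x) x \<le> 5/16 * (1/4) ^ l1_norm n x"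
proof -
  let ?e = "(1/4::real) ^ l1_norm n x"
  have step: "(1/4::real) ^ l1_norm n (x(i := x i + 1)) + (1/4) ^ l1_norm n (x(i := x i - 1))
      \<le> ?e / 2 + (if i \<in> lattice_support n x then 4 * ?e else 0)" if i: "i < n" for i
  proof (cases "x i = 0")
    case True
    then have "l1_norm n (x(i := x i + 1)) = l1_norm n x + 1" "l1_norm n (x(i := x i - 1)) = l1_norm n x + 1"
      using l1_upd[OF i, of x "x i + 1"] l1_upd[OF i, of x "x i - 1"] by auto
    then show ?thesis using True by (simp add: lattice_support_def)
  next
    case False
    define e where "e = ?e"
    have up: "(1/4::real) ^ a = e / 4" if "a = l1_norm n x + 1" for a using that by (simp add: e_def)
    have dn: "(1/4::real) ^ a = e * 4" if "a + 1 = l1_norm n x" for a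
      using that[symmetric] by (simp add: e_def)
    have "e > 0" by (simp add: e_def)
    consider "l1_norm n (x(i := x i + 1)) = l1_norm n x + 1" "l1_norm n (x(i := x i - 1)) + 1 = l1_norm n x"
      | "l1_norm n (x(i := x i + 1)) + 1 = l1_norm n x" "l1_norm n (x(i := x i - 1)) = l1_norm n x + 1"
      using l1_upd[OF i, of x "x i + 1"] l1_upd[OF i, of x "x i - 1"] False by linarith
    then have "(1/4::real) ^ l1_norm n (x(i := x i + 1)) + (1/4) ^ l1_norm n (x(i := x i - 1)) = e / 4 + e * 4"
      by cases (simp_all only: up dn add.commute)
    moreover have "i \<in> lattice_support n x" using False i by (simp add: lattice_support_def)
    ultimately show ?thesis using \<open>e > 0\<close> by (simp add: e_def[symmetric])
  qed
  have "(\<Sum>i<n. (1/4::real) ^ l1_norm n (x(i := x i + 1)) + (1/4) ^ l1_norm n (x(i := x i - 1)))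
     \<le> (\<Sum>i<n. ?e / 2 + (if i \<in> lattice_support n x then 4 * ?e else 0))"
    by (intro sum_mono step) auto
  also have "\<dots> = real n * (?e / 2) + real (card (lattice_support n x)) * (4 * ?e)"
  proof -
    have "{..<n} \<inter> lattice_support n x = lattice_support n x" by (auto simp: lattice_support_def)
    then show ?thesis by (simp add: sum.distrib sum.inter_restrict[symmetric])
  qed
  also have "\<dots> \<le> real n * (?e / 2) + (real n / 64) * (4 * ?e)"
    using s by (intro add_left_mono mult_right_mono) auto
  finally show ?thesis using n by (simp add: walk_avg_def field_simps)
qed

text \<open>
  The walk uses at most one new coordinate per step, so the contraction applies at each of the \<open>t\<close>
  steps as long as the first \<open>t - 1\<close> of them leave the support of size at most \<open>n / 64\<close>.
\<close>
lemma walk_avg_exp_l1: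
  assumes n: "n \<ge> 1" and "64 * (card (lattice_support n x) + t - 1) \<le> n"
  shows "(walk_avg n ^^ t) (\<lambda>x. (1/4) ^ l1_norm n x) x \<le> (5/16) ^ t * (1/4) ^ l1_norm n x"
  using assms(2)
proof (induction t arbitrary: x)
  case (Suc t)
  have *: "(walk_avg n ^^ t) (\<lambda>x. (1/4) ^ l1_norm n x) (x(i := a)) \<le> (5/16) ^ t * (1/4) ^ l1_norm n (x(i := a))"
    for i a
    using Suc.prems supp_upd[of n x i a] by (intro Suc.IH) linarith
  have "(walk_avg n ^^ Suc t) (\<lambda>x. (1/4) ^ l1_norm n x) x
      \<le> walk_avg n (\<lambda>x. (5/16) ^ t * (1/4) ^ l1_norm n x) x"
    unfolding funpow.simps comp_def walk_avg_def[of n "(walk_avg n ^^ t) _"]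
      walk_avg_def[of n "\<lambda>x. (5/16) ^ t * (1/4) ^ l1_norm n x"]
    by (intro divide_right_mono sum_mono add_mono *) auto
  also have "\<dots> = (5/16) ^ t * walk_avg n (\<lambda>x. (1/4) ^ l1_norm n x) x"
    using walk_avg_scale[where t = 1 and n = n] by simp
  also have "\<dots> \<le> (5/16) ^ t * (5/16 * (1/4) ^ l1_norm n x)"
    using Suc.prems by (intro mult_left_mono walk_avg_exp_l1_step n) auto
  finally show ?case by simp
qed simp

text \<open>
  A covariance that vanishes beyond distance \<open>t / 2\<close> is seen by the walk only if after \<open>t\<close> steps it
  is still within distance \<open>t / 2\<close>. This is a Chernoff bound for that event: \<open>2\<^sup>t 4\<^bsup>-|x|\<^esup> \<ge> 1\<close> there, and
  \<open>2 * 5/16 = 5/8\<close>.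
\<close>
lemma walk_avg_moment_upper:
  assumes n: "n \<ge> 1" and t: "64 * (t - 1) \<le> n"
    and bound: "\<And>x. \<rho> x \<le> r" and zero: "\<And>x. 2 * l1_norm n x > t \<Longrightarrow> \<rho> x = 0" and r: "r \<ge> 0"
  shows "(walk_avg n ^^ t) \<rho> (\<lambda>_. 0) \<le> r * (5/8) ^ t"
proof -
  have dom: "\<rho> x \<le> (r * 2 ^ t) * (1/4) ^ l1_norm n x" for x
  proof (cases "2 * l1_norm n x > t")
    case False
    have "(4::real) ^ l1_norm n x = 2 ^ (2 * l1_norm n x)" by (simp add: power_mult)
    also have "\<dots> \<le> 2 ^ t" using False by (intro power_increasing) auto
    finally have "1 \<le> 2 ^ t * (1/4::real) ^ l1_norm n x" by (simp add: field_simps)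
    then have "r * 1 \<le> r * (2 ^ t * (1/4::real) ^ l1_norm n x)" using r by (rule mult_left_mono)
    then show ?thesis using bound[of x] by (simp add: mult.assoc)
  qed (use zero r in simp)
  have "(walk_avg n ^^ t) \<rho> (\<lambda>_. 0) \<le> (walk_avg n ^^ t) (\<lambda>x. (r * 2 ^ t) * (1/4) ^ l1_norm n x) (\<lambda>_. 0)"
    by (rule walk_avg_mono) (rule dom)
  also have "\<dots> = (r * 2 ^ t) * (walk_avg n ^^ t) (\<lambda>x. (1/4) ^ l1_norm n x) (\<lambda>_. 0)"
    by (rule walk_avg_scale)
  also have "\<dots> \<le> (r * 2 ^ t) * ((5/16) ^ t * (1/4) ^ l1_norm n (\<lambda>_. 0))"
    using r t by (intro mult_left_mono walk_avg_exp_l1 n) (auto simp: lattice_support_def)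
  also have "\<dots> = r * (2 * (5/16)) ^ t" unfolding power_mult_distrib by (simp add: l1_norm_def)
  finally show ?thesis by simp
qed

section \<open>Distances, balls and translations of the lattice\<close>

lemma l1_triangle: "l1_norm n (\<lambda>i. w i - u i) \<le> l1_norm n (\<lambda>i. v i - u i) + l1_norm n (\<lambda>i. w i - v i)"
  unfolding l1_norm_def sum.distrib[symmetric] by (intro sum_mono) linarith

lemma l1_edge:
  assumes "(u, v) \<in> int_lattice_edges n"
  shows "l1_norm n (\<lambda>i. v i - u i) \<le> 1"
proof -
  obtain j s where j: "j < n" and v: "v = u(j := u j + s)" and s: "s = 1 \<or> s = - 1"
    using assms unfolding int_lattice_edges_def by fastforce
  have "l1_norm n (\<lambda>i. v i - u i) = (\<Sum>i<n. if i = j then 1 else 0)"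
    unfolding l1_norm_def using s by (intro sum.cong) (auto simp: v)
  then show ?thesis using j by simp
qed

lemma l1_path:
  "(u, v) \<in> int_lattice_edges n ^^ k \<Longrightarrow> l1_norm n (\<lambda>i. v i - u i) \<le> k"
proof (induction k arbitrary: v)
  case (Suc k)
  then obtain w where w: "(u, w) \<in> int_lattice_edges n ^^ k" "(w, v) \<in> int_lattice_edges n" by auto
  show ?case using Suc.IH[OF w(1)] l1_edge[OF w(2)] l1_triangle[of n v u w] by linarith
qed (auto simp: l1_norm_def)

text \<open>
  Connectedness makes the least length in the definition of \<^const>\<open>graph_dist\<close> attained, which is what
  links graph distance to path lengths.
\<close>
lemma int_lattice_connected:
  assumes "u \<in> int_lattice n" "v \<in> int_lattice n"
  shows "\<exists>k. (u, v) \<in> int_lattice_edges n ^^ k"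
  using assms
proof (induction "l1_norm n (\<lambda>i. v i - u i)" arbitrary: u rule: less_induct)
  case less
  show ?case
  proof (cases "u = v")
    case True
    then have "(u, v) \<in> int_lattice_edges n ^^ 0" by simp
    then show ?thesis by blast
  next
    case False
    then obtain j where "u j \<noteq> v j" by auto
    then have j: "j < n" "u j \<noteq> v j"
      using less.prems unfolding int_lattice_def
      by (auto simp: PiE_iff extensional_def) (metis lessThan_iff)
    define s where "s = sgn (v j - u j)"
    have s: "s = 1 \<or> s = - 1" using j by (auto simp: s_def sgn_if)
    define w where "w = u(j := u j + s)"
    have w: "w \<in> int_lattice n" using less.prems j by (auto simp: w_def int_lattice_def PiE_iff extensional_def)
    have e: "(u, w) \<in> int_lattice_edges n"
      using s j w less.prems by (auto simp: int_lattice_edges_def w_def)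
    have "(\<lambda>i. v i - w i) = (\<lambda>i. v i - u i)(j := v j - u j - s)" by (auto simp: w_def)
    then have "l1_norm n (\<lambda>i. v i - w i) + nat \<bar>v j - u j\<bar> = l1_norm n (\<lambda>i. v i - u i) + nat \<bar>v j - u j - s\<bar>"
      using l1_upd[OF j(1), of "\<lambda>i. v i - u i" "v j - u j - s"] by simp
    moreover have "nat \<bar>v j - u j - s\<bar> < nat \<bar>v j - u j\<bar>" using j by (auto simp: s_def sgn_if)
    ultimately have "l1_norm n (\<lambda>i. v i - w i) < l1_norm n (\<lambda>i. v i - u i)" by linarith
    then obtain k where "(w, v) \<in> int_lattice_edges n ^^ k"
      using less.hyps[of w] w less.prems by blast
    with e have "(u, v) \<in> int_lattice_edges n ^^ Suc k" by (metis relpow_Suc_I2)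
    then show ?thesis by blast
  qed
qed

text \<open>
  An edge changes one coordinate by one, so no path is shorter than the \<open>\<ell>\<^sup>1\<close> distance it covers.
\<close>
lemma l1_le_graph_dist:
  assumes "u \<in> int_lattice n" "v \<in> int_lattice n"
  shows "l1_norm n (\<lambda>i. v i - u i) \<le> graph_dist (int_lattice_edges n) u v"
  unfolding graph_dist_def
  by (rule LeastI2_ex[OF int_lattice_connected[OF assms]]) (rule l1_path)

lemma int_lattice_balls_disjoint:
  assumes "u \<in> int_lattice n" "v \<in> int_lattice n" "2 * R < real (l1_norm n (\<lambda>i. v i - u i))"
  shows "graph_ball (int_lattice n) (int_lattice_edges n) R u \<inter>
         graph_ball (int_lattice n) (int_lattice_edges n) R v = {}"
proof (rule ccontr)
  assume "\<not> ?thesis"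
  then obtain w where w: "w \<in> int_lattice n"
     "real (graph_dist (int_lattice_edges n) u w) \<le> R" "real (graph_dist (int_lattice_edges n) v w) \<le> R"
    by (auto simp: graph_ball_def)
  have "l1_norm n (\<lambda>i. v i - w i) = l1_norm n (\<lambda>i. w i - v i)" by (simp add: l1_norm_def abs_minus_commute)
  then have "l1_norm n (\<lambda>i. v i - u i) \<le> graph_dist (int_lattice_edges n) u w + graph_dist (int_lattice_edges n) v w"
    using l1_le_graph_dist[OF assms(1) w(1)] l1_le_graph_dist[OF assms(2) w(1)] l1_triangle[of n v u w]
    by linarith
  then show False using assms(3) w by linarith
qed

definition translate :: "nat \<Rightarrow> (nat \<Rightarrow> int) \<Rightarrow> (nat \<Rightarrow> int) \<Rightarrow> nat \<Rightarrow> int" where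
  "translate n x v = (\<lambda>i\<in>{..<n}. v i + x i)"

lemma translate_in: "translate n x v \<in> int_lattice n"
  by (auto simp: translate_def int_lattice_def)

lemma translate_inverse:
  "v \<in> int_lattice n \<Longrightarrow> translate n (\<lambda>i. - x i) (translate n x v) = v"
  by (auto simp: translate_def int_lattice_def fun_eq_iff PiE_iff extensional_def)

lemma translate_edge:
  assumes "(u, v) \<in> int_lattice_edges n"
  shows "(translate n x u, translate n x v) \<in> int_lattice_edges n"
proof -
  obtain j s where j: "j < n" and v: "v = u(j := u j + s)" and s: "s = 1 \<or> s = - 1"
    using assms unfolding int_lattice_edges_def by fastforce
  have "translate n x v = (translate n x u)(j := translate n x u j + s)"
    using j by (auto simp: v translate_def fun_eq_iff)
  with s j have "\<exists>i<n. translate n x v = (translate n x u)(i := translate n x u i + 1) \<or>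
      translate n x v = (translate n x u)(i := translate n x u i - 1)"
    by auto
  then show ?thesis
    using translate_in unfolding int_lattice_edges_def by blast
qed

lemma translate_aut: "translate n x \<in> graph_aut (int_lattice n) (int_lattice_edges n)"
proof -
  have "bij_betw (translate n x) (int_lattice n) (int_lattice n)"
    by (rule bij_betwI[where g = "translate n (\<lambda>i. - x i)"])
       (use translate_in translate_inverse[of _ n x] translate_inverse[of _ n "\<lambda>i. - x i"] in auto)
  moreover have "(u, v) \<in> int_lattice_edges n"
    if "u \<in> int_lattice n" "v \<in> int_lattice n" "(translate n x u, translate n x v) \<in> int_lattice_edges n" for u v
    using translate_edge[OF that(3), of "\<lambda>i. - x i"] that by (simp add: translate_inverse)
  ultimately show ?thesis
    unfolding graph_aut_def using translate_edge by blast
qed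

section \<open>Factors of IID: invariance and finite-range independence\<close>

lemma prob_space_unit_interval_measure: "prob_space unit_interval_measure"
  unfolding unit_interval_measure_def
  by (rule prob_spaceI) (simp add: space_restrict_space emeasure_restrict_space)

lemma space_unit_interval_measure: "space unit_interval_measure = {0..1}"
  by (simp add: unit_interval_measure_def space_restrict_space)

lemma prob_space_iid_labels: "prob_space (iid_labels V)"
  unfolding iid_labels_def by (intro prob_space_PiM prob_space_unit_interval_measure)

lemma distr_aut_act:
  assumes "bij_betw \<phi> V V"
  shows "distr (iid_labels V) (iid_labels V) (aut_act V \<phi>) = iid_labels V"
  using distr_PiM_reindex[of V "\<lambda>_. unit_interval_measure" "inv_into V \<phi>" V]
    prob_space_unit_interval_measure bij_betw_inv_into[OF assms]
  unfolding iid_labels_def aut_act_def[abs_def] by (auto simp: bij_betw_def)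

lemma aut_act_measurable:
  assumes "bij_betw \<phi> V V"
  shows "aut_act V \<phi> \<in> iid_labels V \<rightarrow>\<^sub>M iid_labels V"
  unfolding iid_labels_def aut_act_def[abs_def]
  using bij_betw_inv_into[OF assms]
  by (intro measurable_restrict measurable_component_singleton) (auto simp: bij_betw_def)

lemma iid_labels_indep:
  assumes "V \<noteq> {}"
  shows "prob_space.indep_vars (iid_labels V) (\<lambda>_. unit_interval_measure) (\<lambda>v z. z v) V"
proof -
  interpret product_prob_space "\<lambda>_. unit_interval_measure" V
    by (intro product_prob_spaceI prob_space_unit_interval_measure)
  have "distr (PiM V (\<lambda>_. unit_interval_measure)) (PiM V (\<lambda>_. unit_interval_measure)) (\<lambda>z. \<lambda>v\<in>V. z v)
    = distr (PiM V (\<lambda>_. unit_interval_measure)) (PiM V (\<lambda>_. unit_interval_measure)) (\<lambda>z. z)"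
    by (rule distr_cong) (auto simp: space_PiM PiE_restrict)
  also have "\<dots> = PiM V (\<lambda>v. distr (PiM V (\<lambda>_. unit_interval_measure)) unit_interval_measure (\<lambda>z. z v))"
    by (simp add: distr_id PiM_component cong: PiM_cong)
  finally show ?thesis
    unfolding iid_labels_def using assms by (subst indep_vars_iff_distr_eq_PiM') auto
qed

locale iid_factor =
  fixes V :: "'v set" and E :: "('v \<times> 'v) set" and R :: real and F :: "('v \<Rightarrow> real) \<Rightarrow> 'v \<Rightarrow> nat"
  assumes factor: "factor_of_iid V E R F"
begin

abbreviation M where "M \<equiv> iid_labels V"

sublocale prob_space M by (rule prob_space_iid_labels)

definition X :: "'v \<Rightarrow> ('v \<Rightarrow> real) \<Rightarrow> real" where
  "X v z = real (F z v)"

lemma F_measurable: "v \<in> V \<Longrightarrow> (\<lambda>z. F z v) \<in> M \<rightarrow>\<^sub>M count_space {0, 1}"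
  using factor unfolding factor_of_iid_def by (auto intro: measurable_component_singleton[THEN measurable_compose[rotated]])

lemma F_values: "v \<in> V \<Longrightarrow> z \<in> space M \<Longrightarrow> F z v = 0 \<or> F z v = 1"
  using measurable_space[OF F_measurable, of v z] by auto

lemma X_measurable [measurable]: "v \<in> V \<Longrightarrow> X v \<in> borel_measurable M"
  unfolding X_def[abs_def] by (rule measurable_compose[OF F_measurable]) auto

lemma X_values: "v \<in> V \<Longrightarrow> z \<in> space M \<Longrightarrow> X v z = 0 \<or> X v z = 1"
  using F_values by (auto simp: X_def)

lemma integrable_X: "v \<in> V \<Longrightarrow> integrable M (X v)"
  using X_values[of v]
  by (intro integrable_const_bound[where B = 1] AE_I2) (force, simp)

lemma integrable_XX: "u \<in> V \<Longrightarrow> v \<in> V \<Longrightarrow> integrable M (\<lambda>z. X u z * X v z)"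
  using X_values[of u] X_values[of v]
  by (intro integrable_const_bound[where B = 1] AE_I2) (force, simp)

lemma expectation_X: "v \<in> V \<Longrightarrow> expectation (X v) = prob {z \<in> space M. F z v = 1}"
proof -
  assume v: "v \<in> V"
  have "{z \<in> space M. F z v = 1} \<in> events"
    using measurable_sets[OF F_measurable[OF v], of "{1}"] by (simp add: vimage_def Int_def conj_commute)
  moreover have "expectation (X v) = expectation (indicator {z \<in> space M. F z v = 1})"
    using F_values[OF v] by (intro Bochner_Integration.integral_cong) (auto simp: X_def indicator_def)
  ultimately show ?thesis by simp
qed

text \<open>
  Equivariance moves the automorphism from the process to the labels, whose law it preserves.
\<close>
lemma aut_invariance:
  assumes \<phi>: "\<phi> \<in> graph_aut V E" and uv: "u \<in> V" "v \<in> V"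
  shows "expectation (\<lambda>z. X (\<phi> u) z * X (\<phi> v) z) = expectation (\<lambda>z. X u z * X v z)"
    and "expectation (X (\<phi> v)) = expectation (X v)"
proof -
  have bij: "bij_betw \<phi> V V" using \<phi> by (simp add: graph_aut_def)
  have mem: "\<phi> w \<in> V" if "w \<in> V" for w using bij that by (rule bij_betw_apply)
  have act: "X (\<phi> w) (aut_act V \<phi> z) = X w z" if "w \<in> V" "z \<in> space M" for w z
  proof -
    have "F (aut_act V \<phi> z) = aut_act V \<phi> (F z)"
      using factor \<phi> that unfolding factor_of_iid_def by blast
    then show ?thesis using that mem bij
      by (simp add: X_def aut_act_def bij_betw_def inv_into_f_f)
  qed
  have *: "expectation g = expectation (\<lambda>z. g (aut_act V \<phi> z))" if "g \<in> borel_measurable M" for g :: "_ \<Rightarrow> real"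
    using integral_distr[OF aut_act_measurable[OF bij], of g] that by (simp add: distr_aut_act[OF bij])
  show "expectation (\<lambda>z. X (\<phi> u) z * X (\<phi> v) z) = expectation (\<lambda>z. X u z * X v z)"
    using uv mem by (subst *) (auto simp: act intro!: Bochner_Integration.integral_cong)
  show "expectation (X (\<phi> v)) = expectation (X v)"
    using uv mem by (subst *) (auto simp: act intro!: Bochner_Integration.integral_cong)
qed

text \<open>
  Values at sites with disjoint balls are functions of disjoint families of labels.
\<close>
lemma finite_range_independence:
  assumes uv: "u \<in> V" "v \<in> V" and disj: "graph_ball V E R u \<inter> graph_ball V E R v = {}"
  shows "expectation (\<lambda>z. X u z * X v z) = expectation (X u) * expectation (X v)"
proof -
  \<comment> \<open>Completing labels on a ball by \<open>0\<close> turns dependence on the ball only into an honest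
    measurable function of the labels restricted to the ball.\<close>
  define ext where "ext B z = (\<lambda>w\<in>V. if w \<in> B then z w else 0)" for B and z :: "'v \<Rightarrow> real"
  let ?B = "graph_ball V E R"
  have BV: "?B w \<subseteq> V" for w by (auto simp: graph_ball_def)
  have ext_meas: "ext (?B w) \<in> PiM (?B w) (\<lambda>_. unit_interval_measure) \<rightarrow>\<^sub>M M" for w
    unfolding iid_labels_def ext_def[abs_def]
  proof (rule measurable_restrict)
    fix u
    show "(\<lambda>z. if u \<in> ?B w then z u else 0)
        \<in> PiM (?B w) (\<lambda>_. unit_interval_measure) \<rightarrow>\<^sub>M unit_interval_measure"
      by (cases "u \<in> ?B w")
         (simp_all add: space_unit_interval_measure measurable_component_singleton)
  qed
  have loc: "X w z = (X w \<circ> ext (?B w)) (restrict z (?B w))" if "w \<in> V" "z \<in> space M" for w z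
  proof -
    have "restrict z (?B w) \<in> space (PiM (?B w) (\<lambda>_. unit_interval_measure))"
      using that BV[of w] by (auto simp: iid_labels_def space_PiM PiE_iff)
    then have "ext (?B w) (restrict z (?B w)) \<in> space M"
      using measurable_space[OF ext_meas] by blast
    moreover have "\<forall>u\<in>?B w. z u = ext (?B w) (restrict z (?B w)) u"
      using BV[of w] by (auto simp: ext_def)
    ultimately show ?thesis
      using factor that unfolding factor_of_iid_def X_def comp_def by metis
  qed
  have "indep_var (PiM (?B u) (\<lambda>_. unit_interval_measure)) (\<lambda>z. restrict (\<lambda>w. z w) (?B u))
                  (PiM (?B v) (\<lambda>_. unit_interval_measure)) (\<lambda>z. restrict (\<lambda>w. z w) (?B v))"
    using uv disj BV by (intro indep_var_restrict[OF iid_labels_indep]) auto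
  then have "indep_var borel ((X u \<circ> ext (?B u)) \<circ> (\<lambda>z. restrict z (?B u)))
                       borel ((X v \<circ> ext (?B v)) \<circ> (\<lambda>z. restrict z (?B v)))"
    by (rule indep_var_compose) (auto intro!: measurable_comp[OF ext_meas] X_measurable uv)
  moreover define Y where "Y w = (X w \<circ> ext (?B w)) \<circ> (\<lambda>z. restrict z (?B w))" for w
  ultimately have ind: "indep_var borel (Y u) borel (Y v)" by simp
  have Y: "Y w z = X w z" if "w \<in> V" "z \<in> space M" for w z
    using loc[OF that] by (simp add: Y_def)
  have "integrable M (Y w)" if "w \<in> V" for w
    using integrable_X[OF that] Y[OF that]
    by (subst Bochner_Integration.integrable_cong[OF refl, of M _ "X w"]) auto
  then have "expectation (\<lambda>z. Y u z * Y v z) = expectation (Y u) * expectation (Y v)"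
    using uv by (intro indep_var_lebesgue_integral ind) auto
  then show ?thesis
    using Y uv by (simp cong: Bochner_Integration.integral_cong)
qed

lemma independent_product_zero:
  assumes "AE z in M. independent_set E {v \<in> V. F z v = 1}" and uv: "u \<in> V" "v \<in> V" "(u, v) \<in> E"
  shows "expectation (\<lambda>z. X u z * X v z) = 0"
proof -
  have "AE z in M. X u z * X v z = 0"
    using assms(1) AE_space
  proof eventually_elim
    case (elim z)
    then show ?case using uv F_values[of u z] F_values[of v z]
      unfolding independent_set_def X_def by auto
  qed
  then show ?thesis by (rule integral_eq_zero_AE)
qed

end

section \<open>The staggered covariance of an independent set\<close>

definition parity_sign :: "nat \<Rightarrow> (nat \<Rightarrow> int) \<Rightarrow> real" where
  "parity_sign n x = (if even (\<Sum>i<n. x i) then 1 else - 1)"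

lemma parity_sign_mult:
  "parity_sign n x * parity_sign n y = parity_sign n (\<lambda>i. y i - x i)"
  by (auto simp: parity_sign_def sum_subtractf)

locale lattice_independent_factor =
  iid_factor "int_lattice n" "int_lattice_edges n" R F for n R F +
  assumes indep_set: "AE z in iid_labels (int_lattice n).
        independent_set (int_lattice_edges n) {v \<in> int_lattice n. F z v = 1}"
begin

text \<open>
  The lattice consists of extensional functions; \<open>site\<close> is the projection onto it from the vectors
  that are used for arithmetic.
\<close>
definition site :: "(nat \<Rightarrow> int) \<Rightarrow> nat \<Rightarrow> int" where
  "site x = restrict x {..<n}"

definition intensity :: real where
  "intensity = expectation (X (site (\<lambda>_. 0)))"

definition joint :: "(nat \<Rightarrow> int) \<Rightarrow> real" where
  "joint x = expectation (\<lambda>z. X (site (\<lambda>_. 0)) z * X (site x) z)"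

text \<open>
  The covariance of the spins \<open>\<plusminus>(2X - 1)\<close> at the origin and at \<open>x\<close>, where the sign is the parity of the
  site. The signs turn an alternating pattern, which a dense independent set resembles, into a
  constant one. The spins themselves are not stationary, since odd translations change their sign,
  but their covariance is translation invariant.
\<close>
definition \<rho> :: "(nat \<Rightarrow> int) \<Rightarrow> real" where
  "\<rho> x = 4 * parity_sign n x * (joint x - intensity\<^sup>2)"

lemma site_in [simp]: "site x \<in> int_lattice n"
  by (auto simp: site_def int_lattice_def)

lemma translate_site: "translate n x (site y) = site (\<lambda>i. y i + x i)"
  by (auto simp: translate_def site_def)

lemma expectation_site: "expectation (X (site x)) = intensity"
  using aut_invariance(2)[OF translate_aut[of n x] site_in[of "\<lambda>_. 0"] site_in[of "\<lambda>_. 0"]]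
  by (simp add: translate_site intensity_def)

lemma joint_site: "expectation (\<lambda>z. X (site x) z * X (site y) z) = joint (\<lambda>i. y i - x i)"
  using aut_invariance(1)[OF translate_aut[of n x] site_in[of "\<lambda>_. 0"] site_in[of "\<lambda>i. y i - x i"]]
  by (simp add: translate_site joint_def)

lemma intensity_eq:
  assumes "v \<in> int_lattice n"
  shows "prob {z \<in> space M. F z v = 1} = intensity"
proof -
  have "v = site v" using assms by (auto simp: site_def int_lattice_def PiE_iff extensional_restrict)
  then show ?thesis using expectation_X[OF assms] expectation_site[of v] by simp
qed

lemma joint_zero: "joint (\<lambda>_. 0) = intensity"
proof -
  have "joint (\<lambda>_. 0) = expectation (X (site (\<lambda>_. 0)))"
    unfolding joint_def using X_values[of "site (\<lambda>_. 0)"]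
    by (intro Bochner_Integration.integral_cong) auto
  then show ?thesis by (simp add: intensity_def)
qed

lemma rho_zero: "\<rho> (\<lambda>_. 0) = 4 * (intensity - intensity\<^sup>2)"
  by (simp add: \<rho>_def joint_zero parity_sign_def)

lemma rho_covariance:
  "has_bochner_integral M
     (\<lambda>z. (2 * parity_sign n x * (X (site x) z - intensity)) * (2 * parity_sign n y * (X (site y) z - intensity)))
     (\<rho> (\<lambda>i. y i - x i))"
proof -
  let ?s = "4 * (parity_sign n x * parity_sign n y)"
  have int: "has_bochner_integral M (X (site v)) intensity" for v
    using integrable_X[OF site_in] expectation_site by (simp add: has_bochner_integral_iff)
  have int2: "has_bochner_integral M (\<lambda>z. X (site x) z * X (site y) z) (joint (\<lambda>i. y i - x i))"
    using integrable_XX[OF site_in site_in] joint_site by (simp add: has_bochner_integral_iff)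
  have int0: "has_bochner_integral M (\<lambda>z. intensity\<^sup>2) (intensity\<^sup>2)"
    by (simp add: has_bochner_integral_iff prob_space)
  have "has_bochner_integral M
     (\<lambda>z. ?s * (X (site x) z * X (site y) z - intensity * X (site x) z - intensity * X (site y) z + intensity\<^sup>2))
     (?s * (joint (\<lambda>i. y i - x i) - intensity * intensity - intensity * intensity + intensity\<^sup>2))"
    by (intro has_bochner_integral_mult_right has_bochner_integral_add has_bochner_integral_diff int int2 int0)
  moreover have "?s * (joint (\<lambda>i. y i - x i) - intensity * intensity - intensity * intensity + intensity\<^sup>2)
      = \<rho> (\<lambda>i. y i - x i)"
    unfolding parity_sign_mult \<rho>_def by (simp add: power2_eq_square)
  moreover have "?s * (X (site x) z * X (site y) z - intensity * X (site x) z - intensity * X (site y) z + intensity\<^sup>2)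
     = (2 * parity_sign n x * (X (site x) z - intensity)) * (2 * parity_sign n y * (X (site y) z - intensity))" for z
    by (simp add: power2_eq_square algebra_simps)
  ultimately show ?thesis by simp
qed

lemma rho_bound: "\<rho> x \<le> \<rho> (\<lambda>_. 0)"
proof -
  define f where "f y z = 2 * parity_sign n y * (X (site y) z - intensity)" for y z
  have cov: "has_bochner_integral M (\<lambda>z. f u z * f v z) (\<rho> (\<lambda>i. v i - u i))" for u v
    unfolding f_def by (rule rho_covariance)
  let ?o = "\<lambda>_. 0 :: int"
  have int: "has_bochner_integral M (\<lambda>z. f ?o z * f ?o z - 2 * (f ?o z * f x z) + f x z * f x z)
      (\<rho> (\<lambda>i. 0 - 0) - 2 * \<rho> (\<lambda>i. x i - 0) + \<rho> (\<lambda>i. x i - x i))"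
    by (intro has_bochner_integral_add has_bochner_integral_diff has_bochner_integral_mult_right cov)
  have "0 \<le> expectation (\<lambda>z. f ?o z * f ?o z - 2 * (f ?o z * f x z) + f x z * f x z)"
  proof (rule Bochner_Integration.integral_nonneg)
    fix z
    have "f ?o z * f ?o z - 2 * (f ?o z * f x z) + f x z * f x z = (f ?o z - f x z)\<^sup>2"
      by (simp add: power2_eq_square algebra_simps)
    then show "0 \<le> f ?o z * f ?o z - 2 * (f ?o z * f x z) + f x z * f x z" by simp
  qed
  then show ?thesis unfolding has_bochner_integral_integral_eq[OF int] by simp
qed

lemma rho_far:
  assumes "2 * R < real (l1_norm n x)"
  shows "\<rho> x = 0"
proof -
  have "l1_norm n (\<lambda>i. site x i - site (\<lambda>_. 0) i) = l1_norm n x" by (simp add: l1_norm_def site_def)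
  then have "joint x = intensity * intensity"
    unfolding joint_def using assms
    by (subst finite_range_independence[OF site_in site_in int_lattice_balls_disjoint])
       (simp_all add: expectation_site)
  then show ?thesis by (simp add: \<rho>_def power2_eq_square)
qed

text \<open>
  The uncentered counterpart of \<open>\<rho>\<close>: the expected product of the two spins.
\<close>
definition corr :: "(nat \<Rightarrow> int) \<Rightarrow> real" where
  "corr x = parity_sign n x * (4 * joint x - 4 * intensity + 1)"

lemma rho_corr: "\<rho> x = corr x - parity_sign n x * (1 - 2 * intensity)\<^sup>2"
  by (simp add: \<rho>_def corr_def power2_eq_square algebra_simps)

lemma corr_spins:
  "has_bochner_integral M
     (\<lambda>z. (parity_sign n x * (2 * X (site x) z - 1)) * (parity_sign n y * (2 * X (site y) z - 1)))
     (corr (\<lambda>i. y i - x i))"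
proof -
  let ?s = "parity_sign n x * parity_sign n y"
  have int: "has_bochner_integral M (X (site v)) intensity" for v
    using integrable_X[OF site_in] expectation_site by (simp add: has_bochner_integral_iff)
  have int2: "has_bochner_integral M (\<lambda>z. X (site x) z * X (site y) z) (joint (\<lambda>i. y i - x i))"
    using integrable_XX[OF site_in site_in] joint_site by (simp add: has_bochner_integral_iff)
  have int0: "has_bochner_integral M (\<lambda>z. 1::real) 1"
    by (simp add: has_bochner_integral_iff prob_space)
  have "has_bochner_integral M
     (\<lambda>z. ?s * (4 * (X (site x) z * X (site y) z) - 2 * X (site x) z - 2 * X (site y) z + 1))
     (?s * (4 * joint (\<lambda>i. y i - x i) - 2 * intensity - 2 * intensity + 1))"
    by (intro has_bochner_integral_mult_right has_bochner_integral_add has_bochner_integral_diff int int2 int0)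
  moreover have "?s * (4 * joint (\<lambda>i. y i - x i) - 2 * intensity - 2 * intensity + 1) = corr (\<lambda>i. y i - x i)"
    unfolding parity_sign_mult corr_def by simp
  moreover have "?s * (4 * (X (site x) z * X (site y) z) - 2 * X (site x) z - 2 * X (site y) z + 1)
     = (parity_sign n x * (2 * X (site x) z - 1)) * (parity_sign n y * (2 * X (site y) z - 1))" for z
    by (simp add: algebra_simps)
  ultimately show ?thesis by simp
qed

text \<open>
  For spins \<open>a\<close>, \<open>b\<close>, \<open>c\<close> with values \<open>\<plusminus>1\<close>, half of \<open>1 - a b\<close> indicates disagreement of \<open>a\<close> and \<open>b\<close>,
  and if \<open>a\<close> and \<open>c\<close> disagree then so do \<open>a\<close> and \<open>b\<close> or \<open>b\<close> and \<open>c\<close>.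
\<close>
lemma corr_triangle:
  "1 - corr (\<lambda>i. w i - u i) \<le> (1 - corr (\<lambda>i. v i - u i)) + (1 - corr (\<lambda>i. w i - v i))"
proof -
  define \<sigma> where "\<sigma> x z = parity_sign n x * (2 * X (site x) z - 1)" for x z
  have c: "has_bochner_integral M (\<lambda>z. \<sigma> x z * \<sigma> y z) (corr (\<lambda>i. y i - x i))" for x y
    unfolding \<sigma>_def by (rule corr_spins)
  have val: "\<sigma> x z = 1 \<or> \<sigma> x z = - 1" if "z \<in> space M" for x z
    using X_values[OF site_in that, of x] by (auto simp: \<sigma>_def parity_sign_def)
  have int: "has_bochner_integral M (\<lambda>z. 1 - \<sigma> u z * \<sigma> v z - \<sigma> v z * \<sigma> w z + \<sigma> u z * \<sigma> w z)
     (1 - corr (\<lambda>i. v i - u i) - corr (\<lambda>i. w i - v i) + corr (\<lambda>i. w i - u i))"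
    by (intro has_bochner_integral_add has_bochner_integral_diff c)
       (simp add: has_bochner_integral_iff prob_space)
  have "0 \<le> 1 - \<sigma> u z * \<sigma> v z - \<sigma> v z * \<sigma> w z + \<sigma> u z * \<sigma> w z" if "z \<in> space M" for z
    using val[OF that, of u] val[OF that, of v] val[OF that, of w] by auto
  then have "0 \<le> expectation (\<lambda>z. 1 - \<sigma> u z * \<sigma> v z - \<sigma> v z * \<sigma> w z + \<sigma> u z * \<sigma> w z)"
    by (rule Bochner_Integration.integral_nonneg)
  then show ?thesis unfolding has_bochner_integral_integral_eq[OF int] by linarith
qed

definition axis :: "nat \<Rightarrow> int \<Rightarrow> nat \<Rightarrow> int" where
  "axis i k = (\<lambda>j. if j = i then k else 0)"

text \<open>
  Neighbouring spins disagree only where both sites are empty, which has probability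
  \<open>1 - 2 intensity\<close>.
\<close>
lemma corr_axis_one:
  assumes "i < n"
  shows "corr (axis i 1) = 4 * intensity - 1"
proof -
  have "(site (\<lambda>_. 0), site (axis i 1)) \<in> int_lattice_edges n"
    using assms site_in
    by (auto simp: int_lattice_edges_def site_def axis_def fun_eq_iff intro!: exI[of _ i])
  then have "joint (axis i 1) = 0"
    unfolding joint_def using independent_product_zero[OF indep_set site_in site_in] by blast
  moreover have "(\<Sum>j<n. axis i 1 j) = 1" using assms by (simp add: axis_def)
  ultimately show ?thesis by (simp add: corr_def parity_sign_def)
qed

lemma corr_zero: "corr (\<lambda>_. 0) = 1"
  by (simp add: corr_def parity_sign_def joint_zero)

lemma corr_axis:
  assumes "i < n"
  shows "1 - corr (axis i (int k)) \<le> real k * (2 - 4 * intensity)"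
proof (induction k)
  case 0
  have "axis i (int 0) = (\<lambda>_. 0)" by (auto simp: axis_def)
  then show ?case by (simp add: corr_zero)
next
  case (Suc k)
  have *: "(\<lambda>j. axis i (int (Suc k)) j - 0) = axis i (int (Suc k))"
    "(\<lambda>j. axis i (int k) j - 0) = axis i (int k)"
    "(\<lambda>j. axis i (int (Suc k)) j - axis i (int k) j) = axis i 1" by (auto simp: axis_def)
  show ?case
    using corr_triangle[of "axis i (int (Suc k))" "\<lambda>_. 0" "axis i (int k)"] Suc
    unfolding * corr_axis_one[OF assms] by (simp add: algebra_simps)
qed

lemma intensity_le_half:
  assumes "n \<ge> 1"
  shows "intensity \<le> 1 / 2"
proof -
  have *: "(\<lambda>j. 0 - axis 0 (- 1) j) = axis 0 1" "(\<lambda>j. axis 0 (- 1) j - 0) = axis 0 (- 1)"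
     "(\<lambda>j. 0 - 0) = (\<lambda>_::nat. 0::int)" by (auto simp: axis_def)
  have "0 \<le> expectation (\<lambda>z. 1 - X (site (\<lambda>_. 0)) z - X (site (axis 0 1)) z +
      X (site (\<lambda>_. 0)) z * X (site (axis 0 1)) z)"
  proof (rule Bochner_Integration.integral_nonneg)
    fix z assume "z \<in> space M"
    then show "0 \<le> 1 - X (site (\<lambda>_. 0)) z - X (site (axis 0 1)) z +
        X (site (\<lambda>_. 0)) z * X (site (axis 0 1)) z"
      using X_values[OF site_in, of z "\<lambda>_. 0"] X_values[OF site_in, of z "axis 0 1"] by auto
  qed
  also have "\<dots> = 1 - intensity - intensity + joint (axis 0 1)"
    using integrable_X[OF site_in] integrable_XX[OF site_in site_in]
    by (simp add: expectation_site joint_def prob_space)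
  also have "joint (axis 0 1) = 0"
  proof -
    have "(\<Sum>j<n. axis 0 1 j) = 1" using assms by (simp add: axis_def)
    then show ?thesis using corr_axis_one[of 0] assms by (simp add: corr_def parity_sign_def)
  qed
  finally show ?thesis by simp
qed

lemma rho_uminus: "\<rho> (\<lambda>i. - x i) = \<rho> x"
proof -
  have "joint (\<lambda>i. - x i) = joint x"
    using joint_site[of x "\<lambda>_. 0"] joint_site[of "\<lambda>_. 0" x] by (simp add: mult.commute)
  then show ?thesis by (simp add: \<rho>_def parity_sign_def sum_negf)
qed

text \<open>
  Along a coordinate line the disagreements add up edge by edge. Centering the spins changes the
  covariance at \<open>0\<close> by \<open>(1 - 2 intensity)\<^sup>2\<close> and elsewhere by at most that much, so it does not
  increase the loss.
\<close>
lemma rho_axis: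
  assumes "i < n"
  shows "\<rho> (axis i (int k)) \<ge> \<rho> (\<lambda>_. 0) - real k * (2 - 4 * intensity)"
proof -
  have "parity_sign n (axis i (int k)) * (1 - 2 * intensity)\<^sup>2 \<le> (1 - 2 * intensity)\<^sup>2"
    by (simp add: parity_sign_def)
  then show ?thesis using corr_axis[OF assms, of k] corr_zero
    unfolding rho_corr by (simp add: parity_sign_def)
qed

section \<open>The density bound\<close>

text \<open>
  The heart of the argument, for a walk of \<open>t = 2\<^sup>k\<close> steps of length \<open>K\<close>. If the conclusion failed,
  one step would keep more than \<open>5/8\<close> of the covariance, hence \<open>t\<close> steps more than \<open>(5/8)\<^sup>t\<close> of it. But
  after \<open>t\<close> steps the walk is typically at distance more than \<open>K t / 2 > 2 R\<close>, where the covariance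
  vanishes, and what survives is at most \<open>(5/8)\<^sup>t\<close>.
\<close>
lemma intensity_bound_scale:
  assumes n: "n \<ge> 1" and p: "0 < intensity" "intensity < 1"
    and t: "64 * (2 ^ k - 1) \<le> n" and K: "4 * R < real K * 2 ^ k"
  shows "3/8 * (4 * (intensity - intensity\<^sup>2)) \<le> real K * (2 - 4 * intensity)"
proof (rule ccontr)
  assume contra: "\<not> ?thesis"
  define r where "r = 4 * (intensity - intensity\<^sup>2)"
  define \<rho>' where "\<rho>' x = \<rho> (\<lambda>i. int K * x i)" for x
  define f where "f z x = 2 * parity_sign n (\<lambda>i. int K * x i) * (X (site (\<lambda>i. int K * x i)) z - intensity)" for z x
  have small: "real K * (2 - 4 * intensity) < 3/8 * r" using contra by (simp add: r_def)
  have rpos: "r > 0"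
  proof -
    have "r = 4 * (intensity * (1 - intensity))" by (simp add: r_def power2_eq_square algebra_simps)
    then show ?thesis using p by simp
  qed
  have r: "\<rho>' (\<lambda>_. 0) = r" by (simp add: \<rho>'_def rho_zero r_def)
  have cov: "has_bochner_integral M (\<lambda>z. f z x * f z y) (\<rho>' (\<lambda>i. y i - x i))" for x y
    using rho_covariance[of "\<lambda>i. int K * x i" "\<lambda>i. int K * y i"] unfolding f_def \<rho>'_def
    by (simp add: right_diff_distrib)
  define q where "q = walk_avg n \<rho>' (\<lambda>_. 0) / r"
  have "walk_avg n \<rho>' (\<lambda>_. 0) > 5/8 * r"
  proof -
    have up: "(\<lambda>j. int K * ((\<lambda>_. 0)(i := 0 + 1)) j) = axis i (int K)" for i
      by (auto simp: axis_def)
    have dn: "(\<lambda>j. int K * ((\<lambda>_. 0)(i := 0 - 1)) j) = (\<lambda>j. - axis i (int K) j)" for i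
      by (auto simp: axis_def)
    define e where "e = r - real K * (2 - 4 * intensity)"
    have ax: "e \<le> \<rho> (axis i (int K))" if "i < n" for i
      using rho_axis[OF that, of K] by (simp add: rho_zero r_def e_def)
    have "(\<Sum>i<n. 2 * e) \<le> (\<Sum>i<n. 2 * \<rho> (axis i (int K)))"
      by (intro sum_mono mult_left_mono ax) auto
    then have "e * (2 * real n) \<le> (\<Sum>i<n. 2 * \<rho> (axis i (int K)))"
      by (simp add: mult_ac)
    moreover have "walk_avg n \<rho>' (\<lambda>_. 0) = (\<Sum>i<n. 2 * \<rho> (axis i (int K))) / (2 * real n)"
      unfolding walk_avg_def \<rho>'_def up dn rho_uminus by simp
    ultimately have "e \<le> walk_avg n \<rho>' (\<lambda>_. 0)"
      using n by (simp add: pos_le_divide_eq)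
    then show ?thesis using small unfolding e_def by linarith
  qed
  then have q: "q > 5/8" "q * r = walk_avg n \<rho>' (\<lambda>_. 0)" using rpos by (simp_all add: q_def field_simps)
  have "q ^ (2 ^ k) * r \<le> (walk_avg n ^^ (2 ^ k)) \<rho>' (\<lambda>_. 0)"
    using walk_avg_moment_lower[of M f \<rho>' q n k, OF cov] rpos q by (simp add: r)
  also have "\<dots> \<le> r * (5/8) ^ (2 ^ k)"
  proof (rule walk_avg_moment_upper)
    fix x assume "2 * l1_norm n x > 2 ^ k"
    then have "(2::real) ^ k < 2 * real (l1_norm n x)"
      by (metis of_nat_less_iff of_nat_mult of_nat_numeral of_nat_power)
    then have "real K * 2 ^ k \<le> real K * (2 * real (l1_norm n x))" by (intro mult_left_mono) auto
    moreover have "l1_norm n (\<lambda>i. int K * x i) = K * l1_norm n x"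
      unfolding l1_norm_def sum_distrib_left
      by (intro sum.cong) (auto simp: abs_mult nat_mult_distrib)
    ultimately show "\<rho>' x = 0" unfolding \<rho>'_def using K by (intro rho_far) simp
  next
    show "\<rho>' x \<le> r" for x unfolding \<rho>'_def using rho_bound by (simp add: rho_zero r_def)
  qed (use n t rpos in auto)
  finally have "q ^ (2 ^ k) \<le> (5/8) ^ (2 ^ k)" using rpos by (simp add: mult.commute)
  moreover have "(5/8) ^ (2 ^ k) < q ^ (2 ^ k)" using q by (intro power_strict_mono) auto
  ultimately show False by simp
qed

text \<open>
  Choose the longest admissible walk, which has \<open>t > n / 128\<close> steps, and then the shortest step
  length \<open>K > 4 R / t\<close>, so that \<open>K \<le> 513 R / n\<close>. The inequality at this scale bounds
  \<open>1 / 2 - intensity\<close> from below by a multiple of \<open>n / R\<close>.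
\<close>
lemma intensity_bound:
  assumes n: "n \<ge> 1" and R: "R > real n"
  shows "intensity \<le> 1 / 2 - real n / (10000 * R)"
proof (rule ccontr)
  assume "\<not> ?thesis"
  then have d: "1 / 2 - intensity < real n / (10000 * R)" by simp
  have Rpos: "R > 0" using R by simp
  have "real n / (10000 * R) \<le> 1 / 10000" using R Rpos by (simp add: field_simps)
  then have p: "intensity > 0" "intensity < 1" "1 / 2 - intensity < 1 / 10000" "intensity \<le> 1 / 2"
    using d intensity_le_half[OF n] by linarith+
  obtain k where k: "64 * (2 ^ k - 1) \<le> n" "\<not> 64 * (2 ^ Suc k - 1) \<le> n"
  proof -
    have ex: "\<exists>m. \<not> 64 * (2 ^ m - 1) \<le> n"
    proof
      have "n < 2 ^ n" by (rule less_exp)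
      then show "\<not> 64 * (2 ^ Suc n - 1) \<le> n" unfolding power_Suc by linarith
    qed
    define m where "m = (LEAST m. \<not> 64 * (2 ^ m - 1 :: nat) \<le> n)"
    have m: "\<not> 64 * (2 ^ m - 1) \<le> n" unfolding m_def by (rule LeastI_ex[OF ex])
    then obtain k where mk: "m = Suc k" by (cases m) auto
    then have "64 * (2 ^ k - 1) \<le> n" using not_less_Least[of k "\<lambda>m. \<not> 64 * (2 ^ m - 1 :: nat) \<le> n"]
      unfolding m_def[symmetric] by auto
    then show ?thesis using that m mk by blast
  qed
  then have "n < 128 * 2 ^ k" by simp
  then have nk: "real n < 128 * 2 ^ k"
    by (metis of_nat_less_iff of_nat_mult of_nat_numeral of_nat_power)
  define K where "K = nat \<lfloor>4 * R / 2 ^ k\<rfloor> + 1"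
  have "real K = of_int \<lfloor>4 * R / 2 ^ k\<rfloor> + 1" using Rpos by (simp add: K_def)
  then have K: "4 * R / 2 ^ k < real K" "real K \<le> 4 * R / 2 ^ k + 1" by linarith+
  have "3/8 * (4 * (intensity - intensity\<^sup>2)) \<le> real K * (2 - 4 * intensity)"
    using n p k K(1) by (intro intensity_bound_scale[of k]) (auto simp: field_simps)
  \<comment> \<open>\<open>4 R / t < 512 R / n\<close>, and rounding up to an integer costs at most \<open>1 \<le> R / n\<close>.\<close>
  also have "\<dots> \<le> (513 * R / real n) * (2 - 4 * intensity)"
  proof (rule mult_right_mono)
    have "4 * R / 2 ^ k \<le> 512 * R / real n"
      using nk n Rpos by (simp add: field_simps mult_left_mono)
    moreover have "1 \<le> R / real n" using R n by (simp add: field_simps)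
    ultimately show "real K \<le> 513 * R / real n" using K(2) by (simp add: add_divide_distrib[symmetric] del: divide_le_eq)
  qed (use p in simp)
  also have "\<dots> \<le> (513 * R / real n) * (4 * (real n / (10000 * R)))"
    using d Rpos by (intro mult_left_mono) auto
  also have "\<dots> = 2052 / 10000" using Rpos n by (simp add: field_simps)
  finally have "4 * (intensity - intensity\<^sup>2) \<le> 6 / 10" by simp
  moreover have "4 * (intensity - intensity\<^sup>2) = 1 - 4 * ((1/2 - intensity) * (1/2 - intensity))"
    by (simp add: power2_eq_square field_simps)
  moreover have "(1/2 - intensity) * (1/2 - intensity) \<le> 1 / 10000 * (1 / 10000)"
    using p by (intro mult_mono) auto
  ultimately show False by simp
qed

end

theorem theorem5:
  "\<exists>c>0::real. \<exists>C>0::real. \<forall>n\<ge>1::nat. \<forall>R::real. \<forall>F::((nat \<Rightarrow> int) \<Rightarrow> real) \<Rightarrow> (nat \<Rightarrow> int) \<Rightarrow> nat.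
     R > C * real n \<longrightarrow>
     factor_of_iid (int_lattice n) (int_lattice_edges n) R F \<longrightarrow>
     (AE z in iid_labels (int_lattice n).
        independent_set (int_lattice_edges n) {v \<in> int_lattice n. F z v = 1}) \<longrightarrow>
     (\<forall>v\<in>int_lattice n.
        measure (iid_labels (int_lattice n)) {z \<in> space (iid_labels (int_lattice n)). F z v = 1}
          \<le> 1 / 2 - c * real n / (R * ln (R / real n)))"
proof (intro exI conjI allI impI ballI)
  show "(0::real) < 1 / 10000" "(0::real) < 3" by simp_all
  fix n :: nat and R :: real and F v
  assume n: "1 \<le> n" and R: "3 * real n < R"
    and F: "factor_of_iid (int_lattice n) (int_lattice_edges n) R F"
    and ind: "AE z in iid_labels (int_lattice n).
        independent_set (int_lattice_edges n) {v \<in> int_lattice n. F z v = 1}"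
    and v: "v \<in> int_lattice n"
  interpret lattice_independent_factor n R F by unfold_locales (rule F, rule ind)
  have ln: "1 \<le> ln (R / real n)"
  proof -
    have "real n * exp 1 \<le> real n * 3" using exp_le by (intro mult_left_mono) auto
    then have "real n * exp 1 \<le> R" using R by linarith
    then have "exp 1 \<le> R / real n" using n by (simp add: le_divide_eq mult.commute)
    then show ?thesis by (metis exp_gt_zero less_le_trans ln_exp ln_mono)
  qed
  have Rpos: "0 < R" using R by simp
  have "1 / 10000 * real n / (R * ln (R / real n)) \<le> 1 / 10000 * real n / (R * 1)"
    using ln Rpos by (intro divide_left_mono mult_left_mono) (auto intro!: mult_pos_pos)
  then show "prob {z \<in> space M. F z v = 1} \<le> 1 / 2 - 1 / 10000 * real n / (R * ln (R / real n))"
    unfolding intensity_eq[OF v] using intensity_bound n R by simp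
qed

end
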